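(* Let $U=\{u^j\}_{j=1}^N\subset X$ be a data set in a Hilbert space $X$, let $\{\lambda_i^{DQ1}\}$ and $\{\varphi_i\}$ be the POD eigenvalues and POD modes of the operator $K_1$ defined in the context, and let $s$ be the number of positive POD eigenvalues. Let $r$ be a positive integer, $X_r=\mathrm{span}\{\varphi_k\}_{k=1}^r$, and let $\Pi_r^X:X\to X$ be the orthogonal projection onto $X_r$. Set $C=4\max\{T^2,T\}$. Then $$\sum_{j=1}^N\Delta t\,\|u^j-\Pi_r^Xu^j\|_X^2\le C\left(\sum_{i=r+1}^s\lambda_i^{DQ1}\right).$$ If $Y$ is a Hilbert space with $U\subset Y$, then $$\sum_{j=1}^N\Delta t\,\|u^j-\Pi_r^Xu^j\|_Y^2\le C\left(\sum_{i=r+1}^s\lambda_i^{DQ1}\|\varphi_i\|_Y^2\right).$$ If in addition $\pi_r:Y\to Y$ is a bounded linear projection onto $X_r$, then $$\sum_{j=1}^N\Delta t\,\|u^j-\pi_ru^j\|_Y^2\le C\left(\sum_{i=r+1}^s\lambda_i^{DQ1}\|\varphi_i-\pi_r\varphi_i\|_Y^2\right).$$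
   Context: $X$ and $Y$ are Hilbert spaces over $\mathbb{K}=\mathbb{R}$ or $\mathbb{C}$ (when both appear, they are linear subspaces of a common vector space, so that the linear operations on common elements agree). $N\ge2$ is an integer, $T>0$, $\Delta t=T/(N-1)$, and $\partial u^j=\frac{u^{j+1}-u^j}{\Delta t}$ for $j=1,\dots,N-1$. Let $S=\mathbb{K}^N$ with the weighted inner product $(g,h)_S=\sum_{j=1}^N\gamma_j g^j\overline{h^j}$, where $\gamma_1=1$ and $\gamma_{j}=\Delta t$ for $j=2,\dots,N$. The operator $K_1:S\to X$ is $$K_1 f=f^1u^1+\sum_{j=1}^{N-1}\Delta t\,f^{j+1}\,\partial u^j,\qquad f=[f^1,\dots,f^N]^T.$$ It has a singular value decomposition with singular values $(\lambda_i^{DQ1})^{1/2}$, in nonincreasing order, and orthonormal singular vectors $f_i\in S$, $\varphi_i\in X$, so that $K_1f_i=(\lambda_i^{DQ1})^{1/2}\varphi_i$. The $\varphi_i$ are the POD modes and the $\lambda_i^{DQ1}$ the POD eigenvalues; $r$ is such that the modes $\varphi_1,\dots,\varphi_r$ exist. A bounded linear operator $\Pi$ on a normed space is a projection onto a subspace $Z_r$ if $\Pi^2=\Pi$ and its range is $Z_r$ (it need not be orthogonal). Empty sums are zero. *)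

theory Defs
  imports "HOL-Analysis.Analysis"
begin

text \<open>
  The scalar field \<open>\<bbbK>\<close>. The axioms say that \<open>to_complex\<close> is an isometric field embedding over the
  reals whose image is all of \<open>\<real>\<close> or all of \<open>\<complex>\<close>, so up to isomorphism \<open>real\<close> and \<open>complex\<close> are the
  only instances, and a statement about \<open>'k::real_or_complex\<close> covers exactly these two cases.
\<close>

class real_or_complex = real_normed_field +
  fixes to_complex :: "'a \<Rightarrow> complex"
    and conjugate :: "'a \<Rightarrow> 'a"
  assumes to_complex_add: "to_complex (a + b) = to_complex a + to_complex b"
    and to_complex_mult: "to_complex (a * b) = to_complex a * to_complex b"
    and to_complex_scaleR: "to_complex (t *\<^sub>R a) = complex_of_real t * to_complex a"
    and norm_to_complex: "cmod (to_complex a) = norm a"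
    and to_complex_conjugate: "to_complex (conjugate a) = cnj (to_complex a)"
    and range_to_complex: "range to_complex = \<real> \<or> range to_complex = UNIV"

instantiation real :: real_or_complex
begin
definition to_complex_real :: "real \<Rightarrow> complex" where "to_complex_real = complex_of_real"
definition conjugate_real :: "real \<Rightarrow> real" where "conjugate_real t = t"
instance
proof
  show "range (to_complex :: real \<Rightarrow> complex) = \<real> \<or> range (to_complex :: real \<Rightarrow> complex) = UNIV"
    unfolding to_complex_real_def Reals_def by (rule disjI1) (rule refl)
qed (simp_all add: to_complex_real_def conjugate_real_def)
end

instantiation complex :: real_or_complex
begin
definition to_complex_complex :: "complex \<Rightarrow> complex" where "to_complex_complex z = z"
definition conjugate_complex :: "complex \<Rightarrow> complex" where "conjugate_complex = cnj"
instance
proof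
  show "range (to_complex :: complex \<Rightarrow> complex) = \<real> \<or> range (to_complex :: complex \<Rightarrow> complex) = UNIV"
    unfolding to_complex_complex_def by (rule disjI2) (rule image_ident)
qed (simp_all add: to_complex_complex_def conjugate_complex_def scaleR_conv_of_real)
end

text \<open>
  Inner products are functions on the whole ambient type; only their values on the carrier matter.
  They are linear in the first argument.
\<close>

definition ip_norm :: "('v \<Rightarrow> 'v \<Rightarrow> 'k::real_or_complex) \<Rightarrow> 'v \<Rightarrow> real"
  where "ip_norm ip x = sqrt (Re (to_complex (ip x x)))"

definition orthonormal_on :: "('v \<Rightarrow> 'v \<Rightarrow> 'k::real_or_complex) \<Rightarrow> 'i set \<Rightarrow> ('i \<Rightarrow> 'v) \<Rightarrow> bool"
  where "orthonormal_on ip I e \<longleftrightarrow> (\<forall>i\<in>I. \<forall>j\<in>I. ip (e i) (e j) = (if i = j then 1 else 0))"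

text \<open>
  A Hilbert space whose underlying vector space is the subspace \<open>X\<close> of the ambient vector space
  \<open>'v\<close>. Carriers are needed because two Hilbert spaces inside the same vector space are compared.
\<close>

locale hilbert_on = vector_space smul
  for smul :: "'k::real_or_complex \<Rightarrow> 'v::ab_group_add \<Rightarrow> 'v" +
  fixes X :: "'v set" and ip :: "'v \<Rightarrow> 'v \<Rightarrow> 'k"
  assumes subspace_carrier: "subspace X"
    and ip_add: "\<lbrakk>x \<in> X; y \<in> X; z \<in> X\<rbrakk> \<Longrightarrow> ip (x + y) z = ip x z + ip y z"
    and ip_scale: "\<lbrakk>x \<in> X; z \<in> X\<rbrakk> \<Longrightarrow> ip (smul c x) z = c * ip x z"
    and ip_conjugate: "\<lbrakk>x \<in> X; y \<in> X\<rbrakk> \<Longrightarrow> ip y x = conjugate (ip x y)"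
    and ip_pos: "\<lbrakk>x \<in> X; x \<noteq> 0\<rbrakk> \<Longrightarrow> 0 < Re (to_complex (ip x x))"
    and complete:
      "\<lbrakk>\<And>n. \<sigma> n \<in> X;
        \<And>e. 0 < e \<Longrightarrow> \<exists>M. \<forall>m\<ge>M. \<forall>n\<ge>M. ip_norm ip (\<sigma> m - \<sigma> n) < e\<rbrakk>
       \<Longrightarrow> \<exists>x\<in>X. (\<lambda>n::nat. ip_norm ip (\<sigma> n - x)) \<longlonglongrightarrow> 0"

definition bounded_linear_op_on ::
  "('k::real_or_complex \<Rightarrow> 'v::ab_group_add \<Rightarrow> 'v) \<Rightarrow> 'v set \<Rightarrow> ('v \<Rightarrow> 'v \<Rightarrow> 'k) \<Rightarrow> ('v \<Rightarrow> 'v) \<Rightarrow> bool"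
  where "bounded_linear_op_on smul X ip P \<longleftrightarrow>
    P ` X \<subseteq> X \<and>
    (\<forall>x\<in>X. \<forall>y\<in>X. P (x + y) = P x + P y) \<and>
    (\<forall>c. \<forall>x\<in>X. P (smul c x) = smul c (P x)) \<and>
    (\<exists>B. \<forall>x\<in>X. ip_norm ip (P x) \<le> B * ip_norm ip x)"

definition projection_on ::
  "('k::real_or_complex \<Rightarrow> 'v::ab_group_add \<Rightarrow> 'v) \<Rightarrow> 'v set \<Rightarrow> ('v \<Rightarrow> 'v \<Rightarrow> 'k)
    \<Rightarrow> ('v \<Rightarrow> 'v) \<Rightarrow> 'v set \<Rightarrow> bool"
  where "projection_on smul X ip P Z \<longleftrightarrow>
    bounded_linear_op_on smul X ip P \<and> (\<forall>x\<in>X. P (P x) = P x) \<and> P ` X = Z"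

definition orthogonal_projection_on ::
  "('k::real_or_complex \<Rightarrow> 'v::ab_group_add \<Rightarrow> 'v) \<Rightarrow> 'v set \<Rightarrow> ('v \<Rightarrow> 'v \<Rightarrow> 'k)
    \<Rightarrow> ('v \<Rightarrow> 'v) \<Rightarrow> 'v set \<Rightarrow> bool"
  where "orthogonal_projection_on smul X ip P Z \<longleftrightarrow>
    projection_on smul X ip P Z \<and> (\<forall>x\<in>X. \<forall>z\<in>Z. ip (x - P x) z = 0)"

text \<open>
  Singular value decomposition of an operator \<open>K\<close> of finite rank from the inner product space
  \<open>(S, ipS)\<close> to \<open>(X, ipX)\<close>. The singular values are \<open>\<sigma> 1 \<ge> \<dots> \<ge> \<sigma> p \<ge> 0\<close>, belonging to the pairs
  \<open>(f i, \<phi> i)\<close> with \<open>i \<le> p\<close>. Zero singular values may or may not be listed, and the vectors \<open>\<phi> i\<close> with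
  \<open>p < i \<le> m\<close> are further orthonormal left singular vectors without a partner (they belong to the
  singular value zero); right singular vectors without a partner play no role and are not listed.
  The last condition says that no nonzero singular value has been left out.
\<close>

definition is_svd ::
  "('k::real_or_complex \<Rightarrow> 'v::ab_group_add \<Rightarrow> 'v) \<Rightarrow> 's set \<Rightarrow> ('s \<Rightarrow> 's \<Rightarrow> 'k)
    \<Rightarrow> 'v set \<Rightarrow> ('v \<Rightarrow> 'v \<Rightarrow> 'k) \<Rightarrow> ('s \<Rightarrow> 'v)
    \<Rightarrow> nat \<Rightarrow> nat \<Rightarrow> (nat \<Rightarrow> real) \<Rightarrow> (nat \<Rightarrow> 's) \<Rightarrow> (nat \<Rightarrow> 'v) \<Rightarrow> bool"
  where "is_svd smul S ipS X ipX K p m \<sigma> f \<phi> \<longleftrightarrow>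
    p \<le> m \<and>
    (\<forall>i\<in>{1..p}. 0 \<le> \<sigma> i) \<and>
    (\<forall>i\<in>{1..p}. \<forall>j\<in>{1..p}. i \<le> j \<longrightarrow> \<sigma> j \<le> \<sigma> i) \<and>
    (\<forall>i\<in>{1..p}. f i \<in> S) \<and> orthonormal_on ipS {1..p} f \<and>
    (\<forall>i\<in>{1..m}. \<phi> i \<in> X) \<and> orthonormal_on ipX {1..m} \<phi> \<and>
    (\<forall>i\<in>{1..p}. K (f i) = smul (of_real (\<sigma> i)) (\<phi> i)) \<and>
    (\<forall>g\<in>S. K g = (\<Sum>i=1..p. smul (of_real (\<sigma> i) * ipS g (f i)) (\<phi> i)))"

definition time_step :: "real \<Rightarrow> nat \<Rightarrow> real"
  where "time_step T N = T / (real N - 1)"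

definition diff_quot ::
  "('k::real_or_complex \<Rightarrow> 'v::ab_group_add \<Rightarrow> 'v) \<Rightarrow> real \<Rightarrow> (nat \<Rightarrow> 'v) \<Rightarrow> nat \<Rightarrow> 'v"
  where "diff_quot smul \<Delta>t u j = smul (of_real (1 / \<Delta>t)) (u (j + 1) - u j)"

text \<open>The space \<open>S\<close>: \<open>\<bbbK>\<^sup>N\<close> as the functions vanishing outside the index set \<open>{1..N}\<close>.\<close>

definition S_space :: "nat \<Rightarrow> (nat \<Rightarrow> 'k::real_or_complex) set"
  where "S_space N = {g. \<forall>j. j \<notin> {1..N} \<longrightarrow> g j = 0}"

definition S_weight :: "real \<Rightarrow> nat \<Rightarrow> real"
  where "S_weight \<Delta>t j = (if j = 1 then 1 else \<Delta>t)"

definition S_inner ::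
  "nat \<Rightarrow> real \<Rightarrow> (nat \<Rightarrow> 'k) \<Rightarrow> (nat \<Rightarrow> 'k) \<Rightarrow> 'k::real_or_complex"
  where "S_inner N \<Delta>t g h = (\<Sum>j=1..N. of_real (S_weight \<Delta>t j) * g j * conjugate (h j))"

definition K1 ::
  "('k::real_or_complex \<Rightarrow> 'v::ab_group_add \<Rightarrow> 'v) \<Rightarrow> nat \<Rightarrow> real \<Rightarrow> (nat \<Rightarrow> 'v)
    \<Rightarrow> (nat \<Rightarrow> 'k) \<Rightarrow> 'v"
  where "K1 smul N \<Delta>t u g =
    smul (g 1) (u 1) + (\<Sum>j=1..N-1. smul (of_real \<Delta>t * g (j + 1)) (diff_quot smul \<Delta>t u j))"

end

theory Submission
  imports Defs
begin

text \<open>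
  Let \<open>A = id - P\<close>, where \<open>P\<close> is one of the projections, and let \<open>w j = A (u j)\<close>. Two facts
  combine.

  Since \<open>w j\<close> is \<open>w 1\<close> plus a sum of increments, a discrete Poincare inequality
  (\<open>sum_norms_le_K1_column_norms\<close>) bounds \<open>\<Sum>j. \<Delta>t \<parallel>w j\<parallel>\<^sup>2\<close> by \<open>C\<close> times the energy
  \<open>\<parallel>w 1\<parallel>\<^sup>2 + \<Sum>j. \<Delta>t \<parallel>\<partial>w j\<parallel>\<^sup>2\<close>.

  This energy is the squared Hilbert-Schmidt norm of \<open>A K\<close>, where \<open>K\<close> is the operator of the data:
  up to the weights, \<open>u 1\<close> and the difference quotients are the columns of \<open>K\<close>. Evaluated on the
  orthonormal right singular vectors instead, the norm equals \<open>\<Sum>i. \<lambda> i \<parallel>A (\<phi> i)\<parallel>\<^sup>2\<close>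
  (\<open>weighted_column_norms_eq\<close>). This holds in the norm of any Hilbert space \<open>Y\<close> that contains the
  vectors \<open>A (\<phi> i)\<close> with \<open>\<lambda> i > 0\<close>; the modes with \<open>\<lambda> i > 0\<close> lie in the span of the data,
  hence in \<open>Y\<close> whenever the data do.

  Every \<open>P\<close> with range \<open>X\<^sub>r\<close> fixes the first \<open>r\<close> modes, so the sum starts at \<open>r + 1\<close>; the
  orthogonal projection in addition annihilates the later modes, so that there \<open>A (\<phi> i) = \<phi> i\<close>.
\<close>

section \<open>The scalar field\<close>

lemma to_complex_0 [simp]: "to_complex 0 = 0"
  using to_complex_add [of 0 0] by simp

lemma to_complex_1 [simp]: "to_complex (1::'k::real_or_complex) = 1"
proof -
  have "to_complex (1::'k) * to_complex (1::'k) = to_complex (1::'k)"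
    using to_complex_mult [of "1::'k" 1] by simp
  moreover have "to_complex (1::'k) \<noteq> 0"
    using norm_to_complex [of "1::'k"] by auto
  ultimately show ?thesis by simp
qed

lemma to_complex_of_real [simp]: "to_complex (of_real t :: 'k::real_or_complex) = of_real t"
  using to_complex_scaleR [of t "1::'k"] by (simp add: of_real_def)

lemma to_complex_minus: "to_complex (- a) = - to_complex a"
  using to_complex_add [of a "- a"] by (simp add: eq_neg_iff_add_eq_0 add.commute)

lemma to_complex_diff: "to_complex (a - b) = to_complex a - to_complex b"
  using to_complex_add [of a "- b"] by (simp add: to_complex_minus)

lemma to_complex_sum: "to_complex (sum g I) = (\<Sum>i\<in>I. to_complex (g i))"
  by (induction I rule: infinite_finite_induct) (simp_all add: to_complex_add)

lemma to_complex_eq_iff: "to_complex a = to_complex b \<longleftrightarrow> a = b"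
proof
  assume "to_complex a = to_complex b"
  then have "norm (a - b) = 0"
    using norm_to_complex [of "a - b"] by (simp add: to_complex_diff)
  then show "a = b" by simp
qed simp

lemma conjugate_0 [simp]: "conjugate 0 = 0"
  by (simp add: to_complex_eq_iff [symmetric] to_complex_conjugate)

lemma conjugate_add: "conjugate (a + b) = conjugate a + conjugate b"
  by (simp add: to_complex_eq_iff [symmetric] to_complex_conjugate to_complex_add)

lemma conjugate_mult: "conjugate (a * b) = conjugate a * conjugate b"
  by (simp add: to_complex_eq_iff [symmetric] to_complex_conjugate to_complex_mult)

lemma conjugate_conjugate [simp]: "conjugate (conjugate a) = a"
  by (simp add: to_complex_eq_iff [symmetric] to_complex_conjugate)

lemma conjugate_of_real [simp]: "conjugate (of_real t) = of_real t"
  by (simp add: to_complex_eq_iff [symmetric] to_complex_conjugate)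

lemma conjugate_sum: "conjugate (sum g I) = (\<Sum>i\<in>I. conjugate (g i))"
  by (induction I rule: infinite_finite_induct) (simp_all add: conjugate_add)

section \<open>Inner products on a carrier\<close>

context hilbert_on
begin

lemma ip_zero_left: "z \<in> X \<Longrightarrow> ip 0 z = 0"
  using ip_scale [of z z 0] by simp

lemma ip_sum_left:
  assumes "\<And>i. i \<in> I \<Longrightarrow> x i \<in> X" and "z \<in> X"
  shows "ip (sum x I) z = (\<Sum>i\<in>I. ip (x i) z)"
  using assms
  by (induction I rule: infinite_finite_induct)
     (simp_all add: ip_zero_left ip_add subspace_sum [OF subspace_carrier])

lemma ip_sum_right:
  assumes "\<And>i. i \<in> I \<Longrightarrow> x i \<in> X" and "z \<in> X"
  shows "ip z (sum x I) = (\<Sum>i\<in>I. ip z (x i))"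
proof -
  have "sum x I \<in> X" using assms subspace_sum [OF subspace_carrier] by blast
  then have "ip z (sum x I) = conjugate (ip (sum x I) z)"
    by (rule ip_conjugate) (rule assms)
  also have "\<dots> = (\<Sum>i\<in>I. conjugate (ip (x i) z))"
    using assms by (simp add: ip_sum_left conjugate_sum)
  also have "\<dots> = (\<Sum>i\<in>I. ip z (x i))"
    using assms by (intro sum.cong refl ip_conjugate [symmetric]) auto
  finally show ?thesis .
qed

lemma ip_scale_right:
  assumes "x \<in> X" "z \<in> X"
  shows "ip z (smul c x) = conjugate c * ip z x"
  using assms ip_conjugate [of "smul c x" z] ip_conjugate [of x z]
    subspace_scale [OF subspace_carrier]
  by (simp add: ip_scale conjugate_mult)

lemma ip_norm_power2:
  assumes "x \<in> X"
  shows "(ip_norm ip x)\<^sup>2 = Re (to_complex (ip x x))"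
  using assms ip_pos [of x] ip_zero_left [of 0]
  by (cases "x = 0") (auto simp: ip_norm_def)

lemma ip_norm_scale_power2:
  assumes "x \<in> X"
  shows "(ip_norm ip (smul (of_real c) x))\<^sup>2 = c\<^sup>2 * (ip_norm ip x)\<^sup>2"
  using assms subspace_scale [OF subspace_carrier, of x]
  by (simp add: ip_norm_power2 ip_scale ip_scale_right to_complex_mult)
     (simp add: power2_eq_square)

text \<open>
  Expanding \<open>0 \<le> \<parallel>x - y\<parallel>\<^sup>2\<close> bounds the mixed term by the squares, which is all the
  Cauchy-Schwarz inequality that the estimate for sums below needs.
\<close>

lemma twice_Re_ip_le:
  assumes "x \<in> X" "y \<in> X"
  shows "2 * Re (to_complex (ip x y)) \<le> (ip_norm ip x)\<^sup>2 + (ip_norm ip y)\<^sup>2"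
proof -
  have diff: "x - y \<in> X" using assms by (rule subspace_diff [OF subspace_carrier])
  have add: "ip (x - y) z + ip y z = ip x z" if "z \<in> X" for z
    using ip_add [of "x - y" y z] diff assms that by simp
  have sym: "Re (to_complex (ip w z)) = Re (to_complex (ip z w))" if "w \<in> X" "z \<in> X" for w z
    using ip_conjugate [of z w] that by (simp add: to_complex_conjugate)
  have Re_add: "Re (to_complex (ip (x - y) z)) = Re (to_complex (ip x z)) - Re (to_complex (ip y z))"
    if "z \<in> X" for z
    by (simp add: to_complex_add flip: add [OF that])
  have "0 \<le> (ip_norm ip (x - y))\<^sup>2" by simp
  also have "\<dots> = (ip_norm ip x)\<^sup>2 + (ip_norm ip y)\<^sup>2 - 2 * Re (to_complex (ip x y))"
    using Re_add [OF diff] Re_add [of x] Re_add [of y] sym [of x "x - y"] sym [of y "x - y"]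
      sym [of x y] diff assms by (simp add: ip_norm_power2)
  finally show ?thesis by simp
qed

lemma ip_norm_sum_power2_le:
  assumes "\<And>i. i \<in> I \<Longrightarrow> x i \<in> X"
  shows "(ip_norm ip (sum x I))\<^sup>2 \<le> card I * (\<Sum>i\<in>I. (ip_norm ip (x i))\<^sup>2)"
proof -
  let ?q = "\<lambda>i. (ip_norm ip (x i))\<^sup>2"
  have "(ip_norm ip (sum x I))\<^sup>2 = (\<Sum>i\<in>I. \<Sum>k\<in>I. Re (to_complex (ip (x i) (x k))))"
    using assms subspace_sum [OF subspace_carrier, of I x]
    by (subst sum.swap) (simp add: ip_norm_power2 ip_sum_left ip_sum_right to_complex_sum)
  also have "\<dots> \<le> (\<Sum>i\<in>I. \<Sum>k\<in>I. (?q i + ?q k) / 2)"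
    using twice_Re_ip_le assms by (intro sum_mono) fastforce
  also have "\<dots> = card I * (\<Sum>i\<in>I. ?q i)"
    by (simp add: sum.distrib sum_divide_distrib [symmetric] sum_distrib_left [symmetric])
  finally show ?thesis .
qed

lemma ip_norm_add_power2_le:
  assumes "x \<in> X" "y \<in> X"
  shows "(ip_norm ip (x + y))\<^sup>2 \<le> 2 * (ip_norm ip x)\<^sup>2 + 2 * (ip_norm ip y)\<^sup>2"
proof -
  have "(ip_norm ip (\<Sum>b\<in>{True, False}. if b then x else y))\<^sup>2
      \<le> card {True, False} * (\<Sum>b\<in>{True, False}. (ip_norm ip (if b then x else y))\<^sup>2)"
    by (rule ip_norm_sum_power2_le) (use assms in auto)
  then show ?thesis by (simp del: insert_UNIV)
qed

section \<open>Hilbert-Schmidt norm of an operator in singular value form\<close>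

text \<open>
  The left side is the squared Hilbert-Schmidt norm of \<open>g \<mapsto> \<Sum>i. \<sigma> i (g, f i) a i\<close>, computed from
  its columns. Expanding the squares and summing over \<open>j\<close> first turns the coefficient of
  \<open>(a i, a k)\<close> into \<open>\<sigma> i \<sigma> k (f k, f i)\<close>, which vanishes off the diagonal. The \<open>a i\<close> are
  arbitrary because the projection errors of the modes will take their place.
\<close>

lemma weighted_column_norms_eq:
  fixes f :: "nat \<Rightarrow> nat \<Rightarrow> 'k"
  assumes I: "finite I"
    and a: "\<And>i. i \<in> I \<Longrightarrow> a i \<in> X"
    and f: "orthonormal_on (S_inner N \<Delta>t) I f"
  shows "(\<Sum>j=1..N. S_weight \<Delta>t j *
            (ip_norm ip (\<Sum>i\<in>I. smul (of_real (\<sigma> i) * conjugate (f i j)) (a i)))\<^sup>2)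
       = (\<Sum>i\<in>I. (\<sigma> i)\<^sup>2 * (ip_norm ip (a i))\<^sup>2)"
proof -
  define d where "d j = (\<Sum>i\<in>I. smul (of_real (\<sigma> i) * conjugate (f i j)) (a i))" for j
  have sm: "smul c (a i) \<in> X" if "i \<in> I" for c i
    using a that subspace_scale [OF subspace_carrier] by blast
  have dX: "d j \<in> X" for j
    unfolding d_def using sm by (intro subspace_sum [OF subspace_carrier])
  have dd: "ip (d j) (d j) = (\<Sum>i\<in>I. \<Sum>k\<in>I.
      of_real (\<sigma> i * \<sigma> k) * ip (a i) (a k) * (f k j * conjugate (f i j)))" for j
  proof -
    let ?x = "\<lambda>i. smul (of_real (\<sigma> i) * conjugate (f i j)) (a i)"
    have "ip (d j) (d j) = (\<Sum>i\<in>I. ip (?x i) (d j))"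
      using ip_sum_left [of I ?x "d j", OF sm dX] by (simp only: d_def)
    also have "\<dots> = (\<Sum>i\<in>I. \<Sum>k\<in>I. ip (?x i) (?x k))"
    proof (rule sum.cong [OF refl])
      fix i assume "i \<in> I"
      then show "ip (?x i) (d j) = (\<Sum>k\<in>I. ip (?x i) (?x k))"
        using ip_sum_right [of I ?x "?x i", OF sm sm] by (simp only: d_def)
    qed
    also have "\<dots> = (\<Sum>i\<in>I. \<Sum>k\<in>I.
      of_real (\<sigma> i * \<sigma> k) * ip (a i) (a k) * (f k j * conjugate (f i j)))"
    proof (intro sum.cong refl)
      fix i k assume "i \<in> I" "k \<in> I"
      then have "ip (?x i) (?x k) = (of_real (\<sigma> k) * f k j) *
          ((of_real (\<sigma> i) * conjugate (f i j)) * ip (a i) (a k))"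
        using a sm by (simp only: ip_scale ip_scale_right conjugate_mult
            conjugate_of_real conjugate_conjugate)
      then show "ip (?x i) (?x k)
          = of_real (\<sigma> i * \<sigma> k) * ip (a i) (a k) * (f k j * conjugate (f i j))"
        by (simp only: of_real_mult mult_ac)
    qed
    finally show ?thesis .
  qed
  have "(\<Sum>j=1..N. of_real (S_weight \<Delta>t j) * ip (d j) (d j))
      = (\<Sum>j=1..N. \<Sum>i\<in>I. \<Sum>k\<in>I. of_real (\<sigma> i * \<sigma> k) * ip (a i) (a k) *
          (of_real (S_weight \<Delta>t j) * f k j * conjugate (f i j)))"
    unfolding dd sum_distrib_left by (intro sum.cong refl) (simp only: mult_ac)
  also have "\<dots> = (\<Sum>i\<in>I. \<Sum>k\<in>I. \<Sum>j=1..N. of_real (\<sigma> i * \<sigma> k) * ip (a i) (a k) *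
          (of_real (S_weight \<Delta>t j) * f k j * conjugate (f i j)))"
    by (subst sum.swap, rule sum.cong [OF refl], rule sum.swap)
  also have "\<dots> = (\<Sum>i\<in>I. \<Sum>k\<in>I. of_real (\<sigma> i * \<sigma> k) * ip (a i) (a k) *
          S_inner N \<Delta>t (f k) (f i))"
    by (simp only: S_inner_def sum_distrib_left)
  also have "\<dots> = (\<Sum>i\<in>I. \<Sum>k\<in>I. if k = i then of_real (\<sigma> i * \<sigma> k) * ip (a i) (a k) else 0)"
    using f by (intro sum.cong refl) (auto simp: orthonormal_on_def)
  also have "\<dots> = (\<Sum>i\<in>I. of_real ((\<sigma> i)\<^sup>2) * ip (a i) (a i))"
    using I by (simp add: power2_eq_square)
  finally have "Re (to_complex (\<Sum>j=1..N. of_real (S_weight \<Delta>t j) * ip (d j) (d j)))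
      = Re (to_complex (\<Sum>i\<in>I. of_real ((\<sigma> i)\<^sup>2) * ip (a i) (a i)))"
    by simp
  then have "(\<Sum>j=1..N. S_weight \<Delta>t j * (ip_norm ip (d j))\<^sup>2)
      = (\<Sum>i\<in>I. (\<sigma> i)\<^sup>2 * (ip_norm ip (a i))\<^sup>2)"
    using dX a by (simp add: to_complex_sum to_complex_mult ip_norm_power2 del: of_real_power)
  then show ?thesis by (simp only: d_def)
qed

end

section \<open>Data sets and their increments\<close>

text \<open>
  The column of \<open>K1\<close> that the weight \<open>S_weight \<Delta>t j\<close> multiplies: the initial
  snapshot followed by the difference quotients, shifted by one index.
\<close>

definition K1_column ::
  "('k::real_or_complex \<Rightarrow> 'v::ab_group_add \<Rightarrow> 'v) \<Rightarrow> real \<Rightarrow> (nat \<Rightarrow> 'v) \<Rightarrow> nat \<Rightarrow> 'v"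
  where "K1_column smul \<Delta>t u j = (if j = 1 then u 1 else diff_quot smul \<Delta>t u (j - 1))"

lemma sum_atLeast1_atMost_split:
  fixes g :: "nat \<Rightarrow> 'b::comm_monoid_add"
  assumes "1 \<le> N"
  shows "(\<Sum>j=1..N. g j) = g 1 + (\<Sum>j=1..N-1. g (j + 1))"
proof -
  have "(\<Sum>j=1..N. g j) = g 1 + (\<Sum>j=Suc 1..N. g j)"
    using assms by (simp add: sum.atLeast_Suc_atMost)
  also have "(\<Sum>j=Suc 1..N. g j) = (\<Sum>j=1..N-1. g (j + 1))"
    using sum.shift_bounds_cl_Suc_ivl [of g 1 "N - 1"] assms by simp
  finally show ?thesis .
qed

context hilbert_on
begin

lemma K1_eq_sum_columns:
  assumes "1 \<le> N"
  shows "K1 smul N \<Delta>t u g = (\<Sum>j=1..N. smul (of_real (S_weight \<Delta>t j) * g j) (K1_column smul \<Delta>t u j))"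
  unfolding sum_atLeast1_atMost_split [OF assms]
  by (auto simp: K1_def K1_column_def S_weight_def intro!: sum.cong)

text \<open>
  Column \<open>j\<close> is the image of the multiple of the \<open>j\<close>-th unit vector that represents evaluation
  at \<open>j\<close> in the weighted inner product, hence the factor \<open>1 / S_weight \<Delta>t j\<close>.
\<close>

lemma K1_column_eq_svd:
  assumes svd: "is_svd smul (S_space N) (S_inner N \<Delta>t) X ip (K1 smul N \<Delta>t u) p m \<sigma> f \<phi>"
    and \<Delta>t: "0 < \<Delta>t" and j: "j \<in> {1..N}"
  shows "K1_column smul \<Delta>t u j = (\<Sum>i=1..p. smul (of_real (\<sigma> i) * conjugate (f i j)) (\<phi> i))"
proof -
  define g :: "nat \<Rightarrow> 'k" where "g k = (if k = j then of_real (1 / S_weight \<Delta>t j) else 0)" for k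
  have w: "S_weight \<Delta>t j \<noteq> 0" using \<Delta>t by (simp add: S_weight_def)
  have wg: "of_real (S_weight \<Delta>t k) * g k = (if k = j then 1 else 0)" for k
    using w by (simp add: g_def flip: of_real_mult)
  have gS: "g \<in> S_space N" using j by (auto simp: S_space_def g_def)
  have inner: "S_inner N \<Delta>t g h = conjugate (h j)" for h
  proof -
    have "S_inner N \<Delta>t g h = (\<Sum>k=1..N. if k = j then conjugate (h j) else 0)"
      unfolding S_inner_def wg by (intro sum.cong refl) simp
    then show ?thesis using j by simp
  qed
  have "K1 smul N \<Delta>t u g = (\<Sum>k=1..N. smul (if k = j then 1 else 0) (K1_column smul \<Delta>t u k))"
    using j by (subst K1_eq_sum_columns) (simp_all add: wg)
  also have "\<dots> = (\<Sum>k=1..N. if k = j then K1_column smul \<Delta>t u j else 0)"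
    by (intro sum.cong refl) simp
  finally have "K1 smul N \<Delta>t u g = K1_column smul \<Delta>t u j"
    using j by simp
  moreover have "K1 smul N \<Delta>t u g = (\<Sum>i=1..p. smul (of_real (\<sigma> i) * conjugate (f i j)) (\<phi> i))"
    using svd gS by (simp add: is_svd_def inner)
  ultimately show ?thesis by simp
qed

lemma smul_diff_quot:
  assumes "\<Delta>t \<noteq> 0"
  shows "smul (of_real \<Delta>t) (diff_quot smul \<Delta>t u j) = u (j + 1) - u j"
  using assms by (simp add: diff_quot_def flip: of_real_mult)

lemma data_mem_if_K1_columns_mem:
  assumes V: "subspace V" and \<Delta>t: "\<Delta>t \<noteq> 0"
    and col: "\<And>j. j \<in> {1..N} \<Longrightarrow> K1_column smul \<Delta>t u j \<in> V"
    and j: "j \<in> {1..N}"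
  shows "u j \<in> V"
proof -
  have "1 \<le> j" using j by simp
  then show ?thesis using j
  proof (induction j rule: dec_induct)
    case base
    then show ?case using col [of 1] by (simp add: K1_column_def)
  next
    case (step k)
    have "diff_quot smul \<Delta>t u k \<in> V"
      using col [of "k + 1"] step by (simp add: K1_column_def)
    then have "u k + smul (of_real \<Delta>t) (diff_quot smul \<Delta>t u k) \<in> V"
      using step by (intro subspace_add [OF V] subspace_scale [OF V]) auto
    then show ?case by (simp add: smul_diff_quot [OF \<Delta>t])
  qed
qed

text \<open>
  A discrete Poincare inequality. Telescoping writes \<open>w j\<close> as \<open>w 1\<close> plus at most
  \<open>N - 1\<close> increments, and \<open>(N - 1) \<Delta>t = T\<close> turns the square of their sum into \<open>T\<close> times
  the weighted energy of the difference quotients. Summing over \<open>j\<close> costs the factor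
  \<open>N \<Delta>t \<le> 2 T\<close>.
\<close>

lemma sum_norms_le_K1_column_norms:
  assumes N: "2 \<le> N" and T: "0 < T" and \<Delta>t: "\<Delta>t = time_step T N"
    and w: "\<And>j. j \<in> {1..N} \<Longrightarrow> w j \<in> X"
  shows "(\<Sum>j=1..N. \<Delta>t * (ip_norm ip (w j))\<^sup>2)
    \<le> 4 * max (T\<^sup>2) T * (\<Sum>j=1..N. S_weight \<Delta>t j * (ip_norm ip (K1_column smul \<Delta>t w j))\<^sup>2)"
proof -
  define E where "E = (\<Sum>k=1..N-1. \<Delta>t * (ip_norm ip (diff_quot smul \<Delta>t w k))\<^sup>2)"
  define A where "A = (ip_norm ip (w 1))\<^sup>2"
  have pos: "0 < \<Delta>t" and Teq: "real (N - 1) * \<Delta>t = T" and NT: "real N * \<Delta>t \<le> 2 * T"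
    using N T by (auto simp: \<Delta>t time_step_def of_nat_diff field_simps)
  have E0: "0 \<le> E" unfolding E_def using pos by (intro sum_nonneg) simp
  have A0: "0 \<le> A" by (simp add: A_def)
  have cols: "(\<Sum>j=1..N. S_weight \<Delta>t j * (ip_norm ip (K1_column smul \<Delta>t w j))\<^sup>2) = A + E"
    using N by (subst sum_atLeast1_atMost_split)
      (auto simp: A_def E_def S_weight_def K1_column_def intro!: sum.cong)
  have dq: "diff_quot smul \<Delta>t w k \<in> X" if "k \<in> {1..N-1}" for k
    using that w N unfolding diff_quot_def
    by (intro subspace_scale [OF subspace_carrier] subspace_diff [OF subspace_carrier]) auto
  have pointwise: "(ip_norm ip (w j))\<^sup>2 \<le> 2 * A + 2 * (T * E)" if j: "j \<in> {1..N}" for j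
  proof -
    let ?x = "\<lambda>k. smul (of_real \<Delta>t) (diff_quot smul \<Delta>t w k)"
    have xX: "?x k \<in> X" if "k \<in> {1..<j}" for k
      using that j by (intro subspace_scale [OF subspace_carrier] dq) auto
    have "(\<Sum>k=1..<j. ?x k) = w j - w 1"
      using pos j sum_Suc_diff' [of 1 j w] by (simp add: smul_diff_quot)
    then have wj: "w j = w 1 + (\<Sum>k=1..<j. ?x k)" by simp
    have "(ip_norm ip (\<Sum>k=1..<j. ?x k))\<^sup>2
        \<le> card {1..<j} * (\<Sum>k=1..<j. (ip_norm ip (?x k))\<^sup>2)"
      using xX by (rule ip_norm_sum_power2_le)
    also have "(\<Sum>k=1..<j. (ip_norm ip (?x k))\<^sup>2)
        = \<Delta>t * (\<Sum>k=1..<j. \<Delta>t * (ip_norm ip (diff_quot smul \<Delta>t w k))\<^sup>2)"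
      unfolding sum_distrib_left using j
      by (intro sum.cong refl) (subst ip_norm_scale_power2 [OF dq], auto simp: power2_eq_square)
    also have "real (card {1..<j}) * \<dots> \<le> real (N - 1) * (\<Delta>t * E)"
      unfolding E_def using j pos
      by (intro mult_mono mult_left_mono sum_mono2 sum_nonneg mult_nonneg_nonneg) auto
    also have "\<dots> = T * E" by (simp add: Teq [symmetric])
    finally have "(ip_norm ip (\<Sum>k=1..<j. ?x k))\<^sup>2 \<le> T * E" .
    moreover have "(\<Sum>k=1..<j. ?x k) \<in> X"
      using xX by (rule subspace_sum [OF subspace_carrier])
    ultimately show ?thesis
      using ip_norm_add_power2_le [of "w 1" "\<Sum>k=1..<j. ?x k"] w [of 1] N
      by (subst wj) (simp add: A_def)
  qed
  have "(\<Sum>j=1..N. \<Delta>t * (ip_norm ip (w j))\<^sup>2) \<le> (\<Sum>j=1..N. \<Delta>t * (2 * A + 2 * (T * E)))"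
    using pos pointwise by (intro sum_mono mult_left_mono) auto
  also have "\<dots> = (real N * \<Delta>t) * (2 * A + 2 * (T * E))" by simp
  also have "\<dots> \<le> (2 * T) * (2 * A + 2 * (T * E))"
    using NT A0 E0 T by (intro mult_right_mono) auto
  also have "\<dots> = 4 * (T * A + T\<^sup>2 * E)" by (simp add: algebra_simps power2_eq_square)
  also have "\<dots> \<le> 4 * (max (T\<^sup>2) T * A + max (T\<^sup>2) T * E)"
    using A0 E0 by (intro mult_left_mono add_mono mult_right_mono) auto
  finally show ?thesis unfolding cols by (simp only: distrib_left mult.assoc)
qed

section \<open>Errors of linear maps on the data\<close>

text \<open>
  A linear map \<open>A\<close> commutes with forming the columns, and sends the singular value form of the
  data to one with \<open>A (\<phi> i)\<close> in place of \<open>\<phi> i\<close>. The domain \<open>W\<close> of linearity and the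
  carrier \<open>X\<close> of the norm are kept apart: the orthogonal projection is linear on one Hilbert space
  while its error is measured in the norm of another.
\<close>

lemma sum_norms_linear_image_le:
  fixes f :: "nat \<Rightarrow> nat \<Rightarrow> 'k"
  assumes N: "2 \<le> N" and T: "0 < T" and \<Delta>t: "\<Delta>t = time_step T N"
    and W: "subspace W"
    and A_add: "\<And>x y. x \<in> W \<Longrightarrow> y \<in> W \<Longrightarrow> A (x + y) = A x + A y"
    and A_scale: "\<And>c x. x \<in> W \<Longrightarrow> A (smul c x) = smul c (A x)"
    and u: "\<And>j. j \<in> {1..N} \<Longrightarrow> u j \<in> W"
    and I: "finite I" and f: "orthonormal_on (S_inner N \<Delta>t) I f"
    and \<phi>: "\<And>i. i \<in> I \<Longrightarrow> \<phi> i \<in> W" and A\<phi>: "\<And>i. i \<in> I \<Longrightarrow> A (\<phi> i) \<in> X"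
    and col: "\<And>j. j \<in> {1..N} \<Longrightarrow>
      K1_column smul \<Delta>t u j = (\<Sum>i\<in>I. smul (of_real (\<sigma> i) * conjugate (f i j)) (\<phi> i))"
  shows "(\<Sum>j=1..N. \<Delta>t * (ip_norm ip (A (u j)))\<^sup>2)
    \<le> 4 * max (T\<^sup>2) T * (\<Sum>i\<in>I. (\<sigma> i)\<^sup>2 * (ip_norm ip (A (\<phi> i)))\<^sup>2)"
proof -
  define w where "w = (\<lambda>j. A (u j))"
  have A_zero: "A 0 = 0" using A_scale [of 0 0] subspace_0 [OF W] by simp
  have A_diff: "A (x - y) = A x - A y" if "x \<in> W" "y \<in> W" for x y
    using A_add [of "x - y" y] that subspace_diff [OF W] by simp
  have A_sum: "A (sum x J) = (\<Sum>i\<in>J. A (x i))" if "finite J" "\<And>i. i \<in> J \<Longrightarrow> x i \<in> W"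
    for x :: "nat \<Rightarrow> 'v" and J
    using that by (induction J rule: finite_induct) (simp_all add: A_zero A_add subspace_sum [OF W])
  have wcol: "K1_column smul \<Delta>t w j = (\<Sum>i\<in>I. smul (of_real (\<sigma> i) * conjugate (f i j)) (A (\<phi> i)))"
    if j: "j \<in> {1..N}" for j
  proof -
    have "A (K1_column smul \<Delta>t u j) = K1_column smul \<Delta>t w j"
    proof (cases "j = 1")
      case False
      then have "j - 1 \<in> {1..N}" using j by auto
      then have "u j \<in> W" "u (j - 1) \<in> W" using j u by blast+
      then show ?thesis
        using False j subspace_diff [OF W]
        by (simp add: K1_column_def w_def diff_quot_def A_scale A_diff)
    qed (simp add: K1_column_def w_def)
    moreover have "A (K1_column smul \<Delta>t u j)
        = (\<Sum>i\<in>I. A (smul (of_real (\<sigma> i) * conjugate (f i j)) (\<phi> i)))"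
      unfolding col [OF j] using \<phi> subspace_scale [OF W] by (intro A_sum [OF I]) auto
    ultimately show ?thesis using \<phi> by (simp add: A_scale)
  qed
  have \<Delta>t0: "\<Delta>t \<noteq> 0" using N T by (simp add: \<Delta>t time_step_def)
  have "K1_column smul \<Delta>t w j \<in> X" if "j \<in> {1..N}" for j
    unfolding wcol [OF that] using A\<phi>
    by (intro subspace_sum [OF subspace_carrier] subspace_scale [OF subspace_carrier])
  then have "w j \<in> X" if "j \<in> {1..N}" for j
    using that by (rule data_mem_if_K1_columns_mem [OF subspace_carrier \<Delta>t0])
  then have "(\<Sum>j=1..N. \<Delta>t * (ip_norm ip (w j))\<^sup>2)
    \<le> 4 * max (T\<^sup>2) T * (\<Sum>j=1..N. S_weight \<Delta>t j * (ip_norm ip (K1_column smul \<Delta>t w j))\<^sup>2)"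
    by (rule sum_norms_le_K1_column_norms [OF N T \<Delta>t])
  also have "(\<Sum>j=1..N. S_weight \<Delta>t j * (ip_norm ip (K1_column smul \<Delta>t w j))\<^sup>2)
      = (\<Sum>i\<in>I. (\<sigma> i)\<^sup>2 * (ip_norm ip (A (\<phi> i)))\<^sup>2)"
    using weighted_column_norms_eq [OF I A\<phi> f, where \<sigma> = \<sigma>] by (simp add: wcol)
  finally show ?thesis by (simp add: w_def)
qed

end

section \<open>The projection error of the data set\<close>

theorem corollary3p5:
  fixes smul :: "'k::real_or_complex \<Rightarrow> 'v::ab_group_add \<Rightarrow> 'v"
    and X :: "'v set" and ipX :: "'v \<Rightarrow> 'v \<Rightarrow> 'k"
    and N p m r s :: nat and T \<Delta>t C :: real
    and u \<phi> :: "nat \<Rightarrow> 'v" and f :: "nat \<Rightarrow> nat \<Rightarrow> 'k" and lam :: "nat \<Rightarrow> real"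
    and X\<^sub>r :: "'v set" and \<Pi>\<^sub>r :: "'v \<Rightarrow> 'v"
  assumes X: "hilbert_on smul X ipX"
    and N: "2 \<le> N"
    and T: "0 < T"
    and dt: "\<Delta>t = time_step T N"
    and u: "\<forall>j\<in>{1..N}. u j \<in> X"
    and svd: "is_svd smul (S_space N) (S_inner N \<Delta>t) X ipX (K1 smul N \<Delta>t u)
                p m (\<lambda>i. sqrt (lam i)) f \<phi>"
    and s: "s = card {i\<in>{1..p}. 0 < lam i}"
    and r: "1 \<le> r" "r \<le> m"
    and Xr: "X\<^sub>r = module.span smul (\<phi> ` {1..r})"
    and proj: "orthogonal_projection_on smul X ipX \<Pi>\<^sub>r X\<^sub>r"
    and C: "C = 4 * max (T\<^sup>2) T"
  shows "(\<Sum>j=1..N. \<Delta>t * (ip_norm ipX (u j - \<Pi>\<^sub>r (u j)))\<^sup>2) \<le> C * (\<Sum>i=r+1..s. lam i)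
    \<and> (\<forall>Y ipY. hilbert_on smul Y ipY \<and> (\<forall>j\<in>{1..N}. u j \<in> Y) \<longrightarrow>
          (\<Sum>j=1..N. \<Delta>t * (ip_norm ipY (u j - \<Pi>\<^sub>r (u j)))\<^sup>2)
            \<le> C * (\<Sum>i=r+1..s. lam i * (ip_norm ipY (\<phi> i))\<^sup>2)
        \<and> (\<forall>\<pi>\<^sub>r. projection_on smul Y ipY \<pi>\<^sub>r X\<^sub>r \<longrightarrow>
              (\<Sum>j=1..N. \<Delta>t * (ip_norm ipY (u j - \<pi>\<^sub>r (u j)))\<^sup>2)
                \<le> C * (\<Sum>i=r+1..s. lam i * (ip_norm ipY (\<phi> i - \<pi>\<^sub>r (\<phi> i)))\<^sup>2)))"
proof -
  interpret X: hilbert_on smul X ipX by (rule X)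
  have pos: "0 < \<Delta>t" using N T by (simp add: dt time_step_def)
  have svdD: "p \<le> m" "\<And>i. i \<in> {1..p} \<Longrightarrow> 0 \<le> lam i"
    "\<And>i j. i \<in> {1..p} \<Longrightarrow> j \<in> {1..p} \<Longrightarrow> i \<le> j \<Longrightarrow> lam j \<le> lam i"
    "orthonormal_on (S_inner N \<Delta>t) {1..p} f"
    "\<And>i. i \<in> {1..m} \<Longrightarrow> \<phi> i \<in> X" "orthonormal_on ipX {1..m} \<phi>"
    "\<And>i. i \<in> {1..p} \<Longrightarrow> K1 smul N \<Delta>t u (f i) = smul (of_real (sqrt (lam i))) (\<phi> i)"
    using svd unfolding is_svd_def real_sqrt_le_iff real_sqrt_ge_0_iff by blast+
  \<comment> \<open>The positive eigenvalues come first because the eigenvalues are nonincreasing.\<close>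
  have Iset: "{i\<in>{1..p}. 0 < lam i} = {1..s}"
  proof -
    let ?I = "{i\<in>{1..p}. 0 < lam i}"
    have down: "{1..i} \<subseteq> ?I" if "i \<in> ?I" for i
      using that svdD(3) [of _ i] by (auto intro: less_le_trans)
    have "?I \<subseteq> {1..s}"
    proof
      fix i assume i: "i \<in> ?I"
      then have "i \<le> s" using card_mono [OF _ down [OF i]] by (simp add: s)
      with i show "i \<in> {1..s}" by simp
    qed
    then show ?thesis by (intro card_subset_eq) (auto simp: s)
  qed
  have sp: "i \<in> {1..p}" and lam_pos: "0 < lam i" if "i \<in> {1..s}" for i
    using that unfolding Iset [symmetric] by auto
  have sX: "\<phi> i \<in> X" if "i \<in> {1..s}" for i
    using sp [OF that] svdD(1,5) by auto
  have fs: "orthonormal_on (S_inner N \<Delta>t) {1..s} f"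
    using svdD(4) sp unfolding orthonormal_on_def by blast
  have col: "K1_column smul \<Delta>t u j
      = (\<Sum>i=1..s. smul (of_real (sqrt (lam i)) * conjugate (f i j)) (\<phi> i))"
    if "j \<in> {1..N}" for j
  proof -
    have "lam i = 0" if "i \<in> {1..p} - {1..s}" for i
      using that svdD(2) [of i] unfolding Iset [symmetric] by fastforce
    then show ?thesis
      unfolding X.K1_column_eq_svd [OF svd pos that]
      using sp by (intro sum.mono_neutral_right) auto
  qed
  \<comment> \<open>A mode with a positive singular value is a combination of snapshots.\<close>
  have \<phi>_in: "\<phi> i \<in> Y" if i: "i \<in> {1..s}" and Y: "X.subspace Y" and uY: "\<forall>j\<in>{1..N}. u j \<in> Y"
    for i Y
  proof -
    have "K1 smul N \<Delta>t u (f i) \<in> Y"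
      unfolding K1_def diff_quot_def using uY N
      by (intro X.subspace_add [OF Y] X.subspace_sum [OF Y] X.subspace_scale [OF Y]
            X.subspace_diff [OF Y]) auto
    then have "smul (of_real (1 / sqrt (lam i))) (smul (of_real (sqrt (lam i))) (\<phi> i)) \<in> Y"
      using svdD(7) [OF sp [OF i]] X.subspace_scale [OF Y] by metis
    then show ?thesis using lam_pos [OF i] by (simp flip: of_real_mult)
  qed
  have projD: "projection_on smul X ipX \<Pi>\<^sub>r X\<^sub>r"
      "\<And>x z. x \<in> X \<Longrightarrow> z \<in> X\<^sub>r \<Longrightarrow> ipX (x - \<Pi>\<^sub>r x) z = 0"
    using proj unfolding orthogonal_projection_on_def by blast+
  have \<phi>Xr: "\<phi> i \<in> X\<^sub>r" if "i \<in> {1..r}" for i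
    unfolding Xr using that by (intro X.span_base) blast
  have fix_modes: "P (\<phi> i) = \<phi> i" if "projection_on smul Y ip P X\<^sub>r" "i \<in> {1..r}" for Y ip P i
    using that(1) \<phi>Xr [OF that(2)] unfolding projection_on_def by (metis imageE)
  \<comment> \<open>A later mode is orthogonal to \<open>X\<^sub>r\<close>, so its projection is orthogonal to itself.\<close>
  have \<Pi>_mode: "\<Pi>\<^sub>r (\<phi> i) = 0" if i: "i \<in> {r+1..s}" for i
  proof -
    have \<phi>X: "\<phi> i \<in> X" and im: "i \<in> {1..m}" using i sX sp [of i] svdD(1) by auto
    have PXr: "\<Pi>\<^sub>r (\<phi> i) \<in> X\<^sub>r" and XrX: "X\<^sub>r \<subseteq> X"
      using projD(1) \<phi>X unfolding projection_on_def bounded_linear_op_on_def by auto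
    have "X.span (\<phi> ` {1..r}) \<subseteq> {z \<in> X. ipX z (\<phi> i) = 0}"
    proof (rule X.span_minimal)
      show "\<phi> ` {1..r} \<subseteq> {z \<in> X. ipX z (\<phi> i) = 0}"
        using svdD(5,6) r im i unfolding orthonormal_on_def by auto
      show "X.subspace {z \<in> X. ipX z (\<phi> i) = 0}"
        using X.subspace_carrier \<phi>X
        by (auto simp: X.subspace_def X.ip_zero_left X.ip_add X.ip_scale)
    qed
    then have "ipX (\<Pi>\<^sub>r (\<phi> i)) (\<phi> i) = 0" using PXr Xr by blast
    then have "ipX (\<phi> i) (\<Pi>\<^sub>r (\<phi> i)) = 0"
      using X.ip_conjugate [of "\<Pi>\<^sub>r (\<phi> i)" "\<phi> i"] PXr XrX \<phi>X by auto
    moreover have "ipX (\<phi> i - \<Pi>\<^sub>r (\<phi> i)) (\<Pi>\<^sub>r (\<phi> i)) = 0"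
      using projD(2) \<phi>X PXr by blast
    moreover have "ipX (\<phi> i) (\<Pi>\<^sub>r (\<phi> i)) = ipX (\<phi> i - \<Pi>\<^sub>r (\<phi> i)) (\<Pi>\<^sub>r (\<phi> i))
        + ipX (\<Pi>\<^sub>r (\<phi> i)) (\<Pi>\<^sub>r (\<phi> i))"
      using X.ip_add [of "\<phi> i - \<Pi>\<^sub>r (\<phi> i)" "\<Pi>\<^sub>r (\<phi> i)" "\<Pi>\<^sub>r (\<phi> i)"] PXr XrX \<phi>X
        X.subspace_diff [OF X.subspace_carrier] by auto
    ultimately have "ipX (\<Pi>\<^sub>r (\<phi> i)) (\<Pi>\<^sub>r (\<phi> i)) = 0" by simp
    then show ?thesis using X.ip_pos [of "\<Pi>\<^sub>r (\<phi> i)"] PXr XrX by auto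
  qed
  \<comment> \<open>The projection \<open>P\<close> lives on \<open>W\<close>, its error is measured in \<open>Y\<close>.
    The first \<open>r\<close> modes drop out because \<open>P\<close> fixes them.\<close>
  have error: "(\<Sum>j=1..N. \<Delta>t * (ip_norm ipY (u j - P (u j)))\<^sup>2)
      \<le> C * (\<Sum>i=r+1..s. lam i * (ip_norm ipY (\<phi> i - P (\<phi> i)))\<^sup>2)"
    if Y: "hilbert_on smul Y ipY" and W: "X.subspace W" and uW: "\<forall>j\<in>{1..N}. u j \<in> W"
      and P: "projection_on smul W ipW P X\<^sub>r"
      and PY: "\<And>i. i \<in> {r+1..s} \<Longrightarrow> \<phi> i - P (\<phi> i) \<in> Y"
    for Y ipY W ipW P
  proof -
    interpret Y: hilbert_on smul Y ipY by (rule Y)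
    have Pfix: "\<phi> i - P (\<phi> i) = 0" if "i \<in> {1..r}" for i
      using fix_modes [OF P that] by simp
    have Plin: "\<And>x y. x \<in> W \<Longrightarrow> y \<in> W \<Longrightarrow> P (x + y) = P x + P y"
      "\<And>c x. x \<in> W \<Longrightarrow> P (smul c x) = smul c (P x)"
      using P unfolding projection_on_def bounded_linear_op_on_def by blast+
    have mem: "\<phi> i - P (\<phi> i) \<in> Y" if "i \<in> {1..s}" for i
      using that PY [of i] Pfix [of i] X.subspace_0 [OF Y.subspace_carrier]
      by (cases "i \<le> r") auto
    have "(\<Sum>j=1..N. \<Delta>t * (ip_norm ipY (u j - P (u j)))\<^sup>2)
      \<le> 4 * max (T\<^sup>2) T * (\<Sum>i=1..s. (sqrt (lam i))\<^sup>2 * (ip_norm ipY (\<phi> i - P (\<phi> i)))\<^sup>2)"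
      by (rule Y.sum_norms_linear_image_le [where A = "\<lambda>x. x - P x", OF N T dt W])
         (use Plin uW fs mem col \<phi>_in [OF _ W uW] in \<open>auto simp: X.scale_right_diff_distrib\<close>)
    also have "(\<Sum>i=1..s. (sqrt (lam i))\<^sup>2 * (ip_norm ipY (\<phi> i - P (\<phi> i)))\<^sup>2)
        = (\<Sum>i=r+1..s. (sqrt (lam i))\<^sup>2 * (ip_norm ipY (\<phi> i - P (\<phi> i)))\<^sup>2)"
      using Y.ip_zero_left [OF X.subspace_0 [OF Y.subspace_carrier]]
      by (intro sum.mono_neutral_right) (auto simp: Pfix ip_norm_def)
    also have "\<dots> = (\<Sum>i=r+1..s. lam i * (ip_norm ipY (\<phi> i - P (\<phi> i)))\<^sup>2)"
      using lam_pos by (intro sum.cong refl) (auto simp: less_imp_le)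
    finally show ?thesis unfolding C .
  qed
  have error\<Pi>: "(\<Sum>j=1..N. \<Delta>t * (ip_norm ipY (u j - \<Pi>\<^sub>r (u j)))\<^sup>2)
      \<le> C * (\<Sum>i=r+1..s. lam i * (ip_norm ipY (\<phi> i))\<^sup>2)"
    if Y: "hilbert_on smul Y ipY" and uY: "\<forall>j\<in>{1..N}. u j \<in> Y" for Y ipY
  proof -
    have "\<phi> i - \<Pi>\<^sub>r (\<phi> i) \<in> Y" if "i \<in> {r+1..s}" for i
      using that \<phi>_in [OF _ hilbert_on.subspace_carrier [OF Y] uY] by (simp add: \<Pi>_mode)
    from error [OF Y X.subspace_carrier u projD(1) this]
    show ?thesis by (simp add: \<Pi>_mode)
  qed
  have "(ip_norm ipX (\<phi> i))\<^sup>2 = 1" if "i \<in> {r+1..s}" for i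
    using that sX [of i] sp [of i] svdD(1,6)
    by (simp add: X.ip_norm_power2 orthonormal_on_def)
  then have "(\<Sum>j=1..N. \<Delta>t * (ip_norm ipX (u j - \<Pi>\<^sub>r (u j)))\<^sup>2) \<le> C * (\<Sum>i=r+1..s. lam i)"
    using error\<Pi> [OF X u] by simp
  moreover have "(\<Sum>j=1..N. \<Delta>t * (ip_norm ipY (u j - \<pi>\<^sub>r (u j)))\<^sup>2)
      \<le> C * (\<Sum>i=r+1..s. lam i * (ip_norm ipY (\<phi> i - \<pi>\<^sub>r (\<phi> i)))\<^sup>2)"
    if Y: "hilbert_on smul Y ipY" and uY: "\<forall>j\<in>{1..N}. u j \<in> Y"
      and \<pi>: "projection_on smul Y ipY \<pi>\<^sub>r X\<^sub>r" for Y ipY \<pi>\<^sub>r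
  proof -
    have YS: "X.subspace Y" by (rule hilbert_on.subspace_carrier [OF Y])
    have "\<phi> i - \<pi>\<^sub>r (\<phi> i) \<in> Y" if "i \<in> {r+1..s}" for i
      using that \<phi>_in [OF _ YS uY, of i] \<pi>
      unfolding projection_on_def bounded_linear_op_on_def
      by (intro X.subspace_diff [OF YS]) auto
    from error [OF Y YS uY \<pi> this] show ?thesis .
  qed
  ultimately show ?thesis using error\<Pi> by blast
qed

end
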